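(* For $\hat\theta\in\Theta(\hat E)$, the following degrees of freedom determine $\hat\theta$ uniquely: (i) the $x$-component of $\hat\theta$ at the 8 vertices of $\hat E$ and at the midpoints of the 8 edges lying on the faces $\hat x=0$ and $\hat x=1$; (ii) the $y$-component of $\hat\theta$ at the 8 vertices of $\hat E$ and at the midpoints of the 8 edges lying on the faces $\hat y=0$ and $\hat y=1$; (iii) the $z$-component of $\hat\theta$ at the 8 vertices of $\hat E$ and at the midpoints of the 8 edges lying on the faces $\hat z=0$ and $\hat z=1$. Furthermore, for each face $\hat f$ of $\partial\hat E$ with unit normal $\hat n$, if all the degrees of freedom of $\hat\theta\in\Theta(\hat E)$ located on $\hat f$ are zero, then $\hat\theta\times\hat n=0$ on $\hat f$.
   Context: $\hat E=[0,1]^3$ is the unit reference cube with coordinates $(\hat x,\hat y,\hat z)$. $\Theta(\hat E)$ is the space of vector polynomials spanned by: $(p,0,0)^T$ with $p\in\{1,\hat x,\hat y,\hat z,\hat x\hat y,\hat x\hat z,\hat y\hat z,\hat x\hat y\hat z,\hat y^2,\hat z^2,\hat x\hat y^2,\hat x\hat z^2,\hat y^2\hat z,\hat y\hat z^2\}$; $(0,p,0)^T$ with $p\in\{1,\hat x,\hat y,\hat z,\hat x\hat y,\hat x\hat z,\hat y\hat z,\hat x\hat y\hat z,\hat x^2,\hat z^2,\hat x^2\hat y,\hat y\hat z^2,\hat x^2\hat z,\hat x\hat z^2\}$; $(0,0,p)^T$ with $p\in\{1,\hat x,\hat y,\hat z,\hat x\hat y,\hat x\hat z,\hat y\hat z,\hat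 x\hat y\hat z,\hat x^2,\hat y^2,\hat x^2\hat z,\hat y^2\hat z,\hat x^2\hat y,\hat x\hat y^2\}$; and the six vectors $(0,\hat x\hat y\hat z^2,-\hat x\hat y^2\hat z)^T$, $(-\hat x\hat y\hat z^2,0,\hat x^2\hat y\hat z)^T$, $(\hat x\hat y^2\hat z,-\hat x^2\hat y\hat z,0)^T$, $(2\hat x\hat y^2\hat z,2\hat x^2\hat y\hat z,\hat x^2\hat y^2)^T$, $(2\hat x\hat y\hat z^2,\hat x^2\hat z^2,2\hat x^2\hat y\hat z)^T$, $(\hat y^2\hat z^2,2\hat x\hat y\hat z^2,2\hat x\hat y^2\hat z)^T$. A degree of freedom is located on a face $\hat f$ if the point (vertex or edge midpoint) where it is evaluated lies on $\hat f$. *)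

theory Defs
  imports "HOL-Analysis.Analysis" "HOL-Library.Function_Algebras"
begin

text \<open>
  Polynomials are represented by the functions they induce on real 3-space, which is faithful
  because the reals are infinite. All ring operations on functions (including numerals and powers)
  are the pointwise ones of \<^theory>\<open>HOL-Library.Function_Algebras\<close>. As the function type
  is no instance of \<^class>\<open>real_vector\<close>, the span is taken in the following
  vector space.
\<close>

interpretation field_space: vector_space "\<lambda>(c::real) (\<theta>::real^3 \<Rightarrow> real^3) p. c *\<^sub>R \<theta> p"
  by unfold_locales (auto simp: fun_eq_iff algebra_simps)

definition ref_cube :: "(real^3) set"
  where "ref_cube = cbox 0 1"

definition X :: "real^3 \<Rightarrow> real" where "X p = p $ 1"
definition Y :: "real^3 \<Rightarrow> real" where "Y p = p $ 2"
definition Z :: "real^3 \<Rightarrow> real" where "Z p = p $ 3"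

definition vec3 :: "(real^3 \<Rightarrow> real) \<Rightarrow> (real^3 \<Rightarrow> real) \<Rightarrow> (real^3 \<Rightarrow> real) \<Rightarrow> real^3 \<Rightarrow> real^3"
  where "vec3 f g h p = vector [f p, g p, h p]"

definition monomials_x :: "(real^3 \<Rightarrow> real) set" where
  "monomials_x = {1, X, Y, Z, X * Y, X * Z, Y * Z, X * Y * Z, Y^2, Z^2,
     X * Y^2, X * Z^2, Y^2 * Z, Y * Z^2}"

definition monomials_y :: "(real^3 \<Rightarrow> real) set" where
  "monomials_y = {1, X, Y, Z, X * Y, X * Z, Y * Z, X * Y * Z, X^2, Z^2,
     X^2 * Y, Y * Z^2, X^2 * Z, X * Z^2}"

definition monomials_z :: "(real^3 \<Rightarrow> real) set" where
  "monomials_z = {1, X, Y, Z, X * Y, X * Z, Y * Z, X * Y * Z, X^2, Y^2,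
     X^2 * Z, Y^2 * Z, X^2 * Y, X * Y^2}"

definition extra_fields :: "(real^3 \<Rightarrow> real^3) set" where
  "extra_fields =
    {vec3 0 (X * Y * Z^2) (- (X * Y^2 * Z)),
     vec3 (- (X * Y * Z^2)) 0 (X^2 * Y * Z),
     vec3 (X * Y^2 * Z) (- (X^2 * Y * Z)) 0,
     vec3 (2 * X * Y^2 * Z) (2 * X^2 * Y * Z) (X^2 * Y^2),
     vec3 (2 * X * Y * Z^2) (X^2 * Z^2) (2 * X^2 * Y * Z),
     vec3 (Y^2 * Z^2) (2 * X * Y * Z^2) (2 * X * Y^2 * Z)}"

definition Theta :: "(real^3 \<Rightarrow> real^3) set" where
  "Theta = field_space.span
     ((\<lambda>p. vec3 p 0 0) ` monomials_x \<union> (\<lambda>p. vec3 0 p 0) ` monomials_y \<union>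
      (\<lambda>p. vec3 0 0 p) ` monomials_z \<union> extra_fields)"

text \<open>
  The points at which the \<open>i\<close>-th component is evaluated. The midpoint does not depend on how
  the edge is written as a segment.
\<close>

definition dof_points :: "3 \<Rightarrow> (real^3) set" where
  "dof_points i = {v. v extreme_point_of ref_cube} \<union>
     {midpoint a b | a b. closed_segment a b edge_of ref_cube \<and>
        (closed_segment a b \<subseteq> {p. p $ i = 0} \<or> closed_segment a b \<subseteq> {p. p $ i = 1})}"

definition unit_normal :: "(real^3) set \<Rightarrow> real^3 \<Rightarrow> bool" where
  "unit_normal f n \<longleftrightarrow> norm n = 1 \<and> (\<forall>p\<in>f. \<forall>q\<in>f. n \<bullet> (p - q) = 0)"

end

(*
  Collecting terms, the x-component of a field in Theta is A(y,z) + x A'(y,z) + r1 y^2 z^2 with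
  A, A' in the eight-dimensional quadratic serendipity space of the unit square, and likewise for
  the other components with parameters r2, r3. The six extra fields impose only three linear
  relations, which express r1, r2, r3 through the cubic coefficients of A' and its two analogues.
  The eight boundary nodes of the square are unisolvent for serendipity functions, and y^2 z^2
  differs from its serendipity interpolant by the bubble (y - y^2)(z - z^2). Hence if all degrees of
  freedom vanish, the x-component is r1 times the bubble, so A' = 0; similarly for the other primed
  parts, so the three relations give r1 = r2 = r3 = 0. Conversely, interpolating with A, A' fixes
  the primed parts, the relations then fix r1, r2, r3, and adding bubble multiples does not change
  the nodal values.
  On a face, a tangential component is linear in its own direction and quadratic in the other one,
  and its degrees of freedom there sit on the matching 2 x 3 tensor grid.
*)
theory Submission
  imports Defs
begin

section \<open>Faces of the unit cube\<close>

text \<open>Each prescribed value is an extreme of its coordinate on the cube, and an interior point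
  of a segment attains it only if both ends do. Vertices, edges and facets arise when
  \<open>I\<close> is everything, misses one index, or is a singleton.\<close>

lemma slice_face_of_unit_cube:
  fixes c :: "real^'n"
  assumes "\<forall>i\<in>I. c $ i = 0 \<or> c $ i = 1"
  shows "{p \<in> cbox 0 1. \<forall>i\<in>I. p $ i = c $ i} face_of cbox 0 1" (is "?F face_of _")
  unfolding face_of_def
proof (intro conjI ballI impI)
  show "convex ?F"
  proof (rule convexI)
    fix x y :: "real^'n" and u v :: real
    assume *: "x \<in> ?F" "y \<in> ?F" "0 \<le> u" "0 \<le> v" "u + v = 1"
    then have "u *\<^sub>R x + v *\<^sub>R y \<in> cbox 0 1"
      using convexD[OF convex_box(1)] by blast
    moreover have "u * c $ i + v * c $ i = c $ i" for i
      using *(5) by (simp flip: distrib_right)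
    ultimately show "u *\<^sub>R x + v *\<^sub>R y \<in> ?F"
      using * by simp
  qed
next
  fix a b x :: "real^'n"
  assume a: "a \<in> cbox 0 1" and b: "b \<in> cbox 0 1" and x: "x \<in> ?F" "x \<in> open_segment a b"
  obtain u where u: "0 < u" "u < 1" "x = (1 - u) *\<^sub>R a + u *\<^sub>R b"
    using x by (auto simp: in_segment)
  have *: "a $ i = c $ i \<and> b $ i = c $ i" if "i \<in> I" for i
  proof -
    have eq: "(1 - u) * a $ i + u * b $ i = c $ i"
      using x(1) that arg_cong[OF u(3), of "\<lambda>x. x $ i"] by simp
    have ab: "0 \<le> a $ i" "a $ i \<le> 1" "0 \<le> b $ i" "b $ i \<le> 1"
      using a b unfolding mem_box_cart by simp_all
    have "c $ i = 0 \<or> c $ i = 1"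
      using assms that by blast
    then consider "c $ i = 0" | "c $ i = 1" by blast
    then show ?thesis
    proof cases
      case 1
      then have "(1 - u) * a $ i = 0 \<and> u * b $ i = 0"
        using eq ab u(1,2) by (simp add: add_nonneg_eq_0_iff)
      then show ?thesis
        using 1 u(1,2) by simp
    next
      case 2
      then have "(1 - u) * (1 - a $ i) + u * (1 - b $ i) = 0"
        using eq by (simp add: algebra_simps)
      then have "(1 - u) * (1 - a $ i) = 0 \<and> u * (1 - b $ i) = 0"
        using ab u(1,2) by (simp add: add_nonneg_eq_0_iff)
      then show ?thesis
        using 2 u(1,2) by simp
    qed
  qed
  show "a \<in> ?F" "b \<in> ?F"
    using a b * by auto
qed auto

lemma extreme_point_of_unit_cube:
  fixes v :: "real^'n"
  shows "v extreme_point_of cbox 0 1 \<longleftrightarrow> (\<forall>i. v $ i = 0 \<or> v $ i = 1)"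
proof
  assume v: "v extreme_point_of cbox 0 1"
  show "\<forall>i. v $ i = 0 \<or> v $ i = 1"
  proof (rule ccontr)
    assume "\<not> (\<forall>i. v $ i = 0 \<or> v $ i = 1)"
    then obtain i where i: "v $ i \<noteq> 0" "v $ i \<noteq> 1" by blast
    have vc: "0 \<le> v $ j" "v $ j \<le> 1" for j
      using v by (auto simp: extreme_point_of_def mem_box_cart)
    define w where "w t = (\<chi> j. if j = i then t else v $ j)" for t
    have "w 0 \<in> cbox 0 1" "w 1 \<in> cbox 0 1"
      using vc by (auto simp: w_def mem_box_cart)
    moreover have "v \<in> open_segment (w 0) (w 1)"
      unfolding in_segment
    proof (intro conjI exI[of _ "v $ i"])
      show "w 0 \<noteq> w 1" by (auto simp: w_def vec_eq_iff)
      show "0 < v $ i" "v $ i < 1" using vc[of i] i by auto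
      show "v = (1 - v $ i) *\<^sub>R w 0 + (v $ i) *\<^sub>R w 1"
        by (auto simp: w_def vec_eq_iff algebra_simps)
    qed
    ultimately show False
      using v by (auto simp: extreme_point_of_def)
  qed
next
  assume v: "\<forall>i. v $ i = 0 \<or> v $ i = 1"
  then have "0 \<le> v $ i \<and> v $ i \<le> 1" for i
    by (metis order_refl zero_le_one)
  then have "v \<in> cbox 0 1"
    by (simp add: mem_box_cart)
  then have "{p \<in> cbox 0 1. \<forall>i\<in>UNIV. p $ i = v $ i} = {v}"
    by (auto simp: vec_eq_iff)
  with slice_face_of_unit_cube[of UNIV v] v show "v extreme_point_of cbox 0 1"
    by (simp add: face_of_singleton)
qed

text \<open>The ends of an edge are vertices; if they differed in two coordinates, the midpoint
  would also be that of a segment of the cube leaving the edge. Conversely, the segment is the slice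
  on which only coordinate \<open>k\<close> is free.\<close>

lemma edge_of_unit_cube:
  fixes a b :: "real^'n"
  shows "closed_segment a b edge_of cbox 0 1 \<longleftrightarrow>
    (\<forall>i. a $ i = 0 \<or> a $ i = 1) \<and> (\<exists>k. b $ k = 1 - a $ k \<and> (\<forall>i. i \<noteq> k \<longrightarrow> b $ i = a $ i))"
    (is "?L \<longleftrightarrow> ?R")
proof
  assume e: ?L
  then have face: "closed_segment a b face_of cbox 0 1" and dim: "aff_dim (closed_segment a b) = 1"
    by (auto simp: edge_of_def)
  have neq: "a \<noteq> b"
    using dim by (auto simp: segment_convex_hull aff_dim_convex_hull)
  have "a extreme_point_of cbox 0 1" "b extreme_point_of cbox 0 1"
    using extreme_point_of_face[OF face] extreme_point_of_segment by blast+
  then have a: "\<And>i. a $ i = 0 \<or> a $ i = 1" and b: "\<And>i. b $ i = 0 \<or> b $ i = 1"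
    by (auto simp: extreme_point_of_unit_cube)
  obtain k where k: "a $ k \<noteq> b $ k"
    using neq by (auto simp: vec_eq_iff)
  have "b $ i = a $ i" if "i \<noteq> k" for i
  proof (rule ccontr)
    assume i: "b $ i \<noteq> a $ i"
    \<comment> \<open>exchanging the \<open>k\<close>-th coordinates of \<open>a\<close> and \<open>b\<close> keeps their midpoint\<close>
    define a' where "a' = (\<chi> j. if j = k then b $ j else a $ j)"
    define b' where "b' = (\<chi> j. if j = k then a $ j else b $ j)"
    have "0 \<le> a $ j \<and> a $ j \<le> 1" "0 \<le> b $ j \<and> b $ j \<le> 1" for j
      using a[of j] b[of j] by auto
    then have in_cube: "a' \<in> cbox 0 1" "b' \<in> cbox 0 1"
      by (auto simp: a'_def b'_def mem_box_cart)
    have "a' \<noteq> b'"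
      using k by (auto simp: a'_def b'_def vec_eq_iff)
    moreover have "midpoint a b = midpoint a' b'"
      by (auto simp: a'_def b'_def midpoint_def vec_eq_iff)
    ultimately have "midpoint a b \<in> open_segment a' b'"
      by simp
    then have "a' \<in> closed_segment a b"
      using face_ofD[OF face _ in_cube] by simp
    then obtain u where u: "a' = (1 - u) *\<^sub>R a + u *\<^sub>R b"
      by (auto simp: in_segment)
    \<comment> \<open>Coordinate \<open>k\<close> forces \<open>a' = b\<close>, which fails in
      coordinate \<open>i\<close>, where \<open>a'\<close> agrees with \<open>a\<close>.\<close>
    have "b $ k = (1 - u) * a $ k + u * b $ k"
      using arg_cong[OF u, of "\<lambda>x. x $ k"] by (simp add: a'_def)
    then have "(1 - u) * (b $ k - a $ k) = 0"
      by (simp add: algebra_simps)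
    then have "u = 1" using k by simp
    moreover have "a $ i = (1 - u) * a $ i + u * b $ i"
      using arg_cong[OF u, of "\<lambda>x. x $ i"] that by (simp add: a'_def)
    ultimately show False using i by simp
  qed
  moreover have "b $ k = 1 - a $ k"
    using a[of k] b[of k] k by auto
  ultimately show ?R
    using a by blast
next
  assume R: ?R
  then obtain k where a: "\<forall>i. a $ i = 0 \<or> a $ i = 1" and bk: "b $ k = 1 - a $ k"
    and b: "\<And>i. i \<noteq> k \<Longrightarrow> b $ i = a $ i" by blast
  have a01: "0 \<le> a $ j \<and> a $ j \<le> 1" for j
    using a[rule_format, of j] by auto
  have "closed_segment a b = {p \<in> cbox 0 1. \<forall>i\<in>-{k}. p $ i = a $ i}" (is "_ = ?F")
  proof
    have "0 \<le> b $ j \<and> b $ j \<le> 1" for j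
      using a01[of j] b[of j] bk by (cases "j = k") auto
    then have "a \<in> ?F" "b \<in> ?F"
      using a01 b by (auto simp: mem_box_cart)
    then show "closed_segment a b \<subseteq> ?F"
      using slice_face_of_unit_cube[of "-{k}" a] a
      by (intro closed_segment_subset) (auto dest: face_of_imp_convex)
  next
    show "?F \<subseteq> closed_segment a b"
    proof
      fix p assume p: "p \<in> ?F"
      then have pk: "0 \<le> p $ k" "p $ k \<le> 1" by (auto simp: mem_box_cart)
      \<comment> \<open>The absolute value serves both \<open>a $ k = 0\<close> and
        \<open>a $ k = 1\<close>.\<close>
      define u where "u = \<bar>p $ k - a $ k\<bar>"
      have "0 \<le> u" "u \<le> 1"
        using pk a01[of k] by (auto simp: u_def)
      moreover have "p $ i = (1 - u) * a $ i + u * b $ i" for i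
      proof (cases "i = k")
        case True
        have "a $ k = 0 \<or> a $ k = 1" using a by blast
        then show ?thesis using True bk pk by (auto simp: u_def)
      next
        case False
        then show ?thesis using p b by (auto simp: algebra_simps)
      qed
      then have "p = (1 - u) *\<^sub>R a + u *\<^sub>R b"
        by (simp add: vec_eq_iff)
      ultimately show "p \<in> closed_segment a b"
        unfolding in_segment by blast
    qed
  qed
  moreover have "a \<noteq> b"
    using bk a[rule_format, of k] by auto
  then have "aff_dim (closed_segment a b) = 1"
    by (simp add: segment_convex_hull aff_dim_convex_hull)
  ultimately show ?L
    using slice_face_of_unit_cube[of "-{k}" a] a by (simp add: edge_of_def)
qed

text \<open>A functional supporting the cube along \<open>f\<close> depends on some coordinate
  \<open>i\<close>, so \<open>f\<close> lies in the slice at the end of axis \<open>i\<close> where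
  the functional is larger. That slice is a proper face, and the dimension of a facet leaves no room
  between the two.\<close>

lemma facet_of_unit_cube:
  fixes f :: "(real^'n) set"
  assumes "f facet_of cbox 0 1"
  obtains i c where "c = 0 \<or> c = 1" "f = {p \<in> cbox 0 1. p $ i = c}"
proof -
  have face: "f face_of cbox 0 1" and dim: "aff_dim f = aff_dim (cbox 0 1 :: (real^'n) set) - 1"
    using assms by (auto simp: facet_of_def)
  obtain a b where "a \<noteq> 0" and le: "cbox 0 1 \<subseteq> {x. a \<bullet> x \<le> b}"
    and f: "f = cbox 0 1 \<inter> {x. a \<bullet> x = b}"
    using facet_of_polyhedron[OF _ assms] by auto
  then obtain i where i: "a $ i \<noteq> 0"
    by (auto simp: vec_eq_iff)
  define c :: real where "c = (if a $ i > 0 then 1 else 0)"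
  define S where "S = {p \<in> cbox 0 1. p $ i = c}"
  have "f \<subseteq> S"
  proof
    fix p assume p: "p \<in> f"
    define q where "q = p + axis i (c - p $ i)"
    have pc: "\<And>j. 0 \<le> p $ j \<and> p $ j \<le> 1"
      using p f by (auto simp: mem_box_cart)
    then have "q \<in> cbox 0 1"
      by (auto simp: q_def mem_box_cart axis_def c_def)
    then have "a \<bullet> q \<le> b" "a \<bullet> p = b"
      using le p f by auto
    then have "a $ i * (c - p $ i) \<le> 0"
      by (simp add: q_def inner_add_right inner_axis)
    then have "p $ i = c"
      using i pc[of i] by (auto simp: c_def mult_le_0_iff split: if_splits)
    then show "p \<in> S"
      using p f by (simp add: S_def)
  qed
  have S_face: "S face_of cbox 0 1"
    using slice_face_of_unit_cube[of "{i}" "\<chi> j. c"] by (simp add: S_def c_def)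
  have "S \<noteq> cbox 0 1"
  proof -
    have "(\<chi> j. 1 - c) \<in> cbox 0 1" "(\<chi> j. 1 - c) \<notin> S"
      by (auto simp: mem_box_cart S_def c_def)
    then show ?thesis by blast
  qed
  then have "aff_dim S < aff_dim (cbox 0 1 :: (real^'n) set)"
    using face_of_aff_dim_lt[OF convex_box(1) S_face] by simp
  then have "f = S"
    using face_of_aff_dim_lt[OF face_of_imp_convex[OF S_face]
      face_of_subset[OF face \<open>f \<subseteq> S\<close> face_of_imp_subset[OF S_face]]] dim
    by force
  then show thesis
    using that[of c i] by (auto simp: S_def c_def)
qed

text \<open>An edge lies in a face orthogonal to axis \<open>i\<close> exactly when it runs along
  another axis \<open>k\<close>; its midpoint has 1/2 there and 0 or 1 elsewhere.\<close>

lemma mem_dof_points: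
  "p \<in> dof_points i \<longleftrightarrow>
     (\<forall>j. p $ j = 0 \<or> p $ j = 1) \<or>
     (\<exists>k. k \<noteq> i \<and> p $ k = 1/2 \<and> (\<forall>j. j \<noteq> k \<longrightarrow> p $ j = 0 \<or> p $ j = 1))" (is "_ \<longleftrightarrow> ?V \<or> ?M")
proof -
  have "(\<exists>a b. p = midpoint a b \<and> closed_segment a b edge_of ref_cube \<and>
        (closed_segment a b \<subseteq> {p. p $ i = 0} \<or> closed_segment a b \<subseteq> {p. p $ i = 1})) \<longleftrightarrow> ?M"
    (is "?E \<longleftrightarrow> _")
  proof
    assume ?E
    then obtain a b where p: "p = midpoint a b"
      and e: "closed_segment a b edge_of cbox 0 1"
      and sub: "closed_segment a b \<subseteq> {p. p $ i = 0} \<or> closed_segment a b \<subseteq> {p. p $ i = 1}"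
      by (auto simp: ref_cube_def)
    obtain k where a: "\<forall>j. a $ j = 0 \<or> a $ j = 1" and bk: "b $ k = 1 - a $ k"
      and b: "\<And>j. j \<noteq> k \<Longrightarrow> b $ j = a $ j"
      using e by (auto simp: edge_of_unit_cube)
    have "a $ i = b $ i"
    proof -
      have "a \<in> closed_segment a b" "b \<in> closed_segment a b" by simp_all
      then have "(a $ i = 0 \<and> b $ i = 0) \<or> (a $ i = 1 \<and> b $ i = 1)"
        using sub by blast
      then show ?thesis by auto
    qed
    then have "k \<noteq> i"
      using bk a[rule_format, of k] by auto
    moreover have "p $ k = 1/2"
      by (simp add: p midpoint_def bk)
    moreover have "p $ j = a $ j" if "j \<noteq> k" for j
      using b[OF that] by (simp add: p midpoint_def)
    ultimately show ?M
      using a by metis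
  next
    assume ?M
    then obtain k where k: "k \<noteq> i" "p $ k = 1/2" "\<And>j. j \<noteq> k \<Longrightarrow> p $ j = 0 \<or> p $ j = 1"
      by blast
    define w where "w t = (\<chi> j. if j = k then t else p $ j)" for t
    have "p = midpoint (w 0) (w 1)"
      using k by (auto simp: w_def midpoint_def vec_eq_iff)
    moreover have "closed_segment (w 0) (w 1) edge_of ref_cube"
      unfolding ref_cube_def edge_of_unit_cube
      using k(3) by (auto simp: w_def)
    moreover have "closed_segment (w 0) (w 1) \<subseteq> {q. q $ i = p $ i}"
    proof
      fix q assume "q \<in> closed_segment (w 0) (w 1)"
      then obtain u where "q = (1 - u) *\<^sub>R w 0 + u *\<^sub>R w 1"
        by (auto simp: in_segment)
      then have "q $ i = (1 - u) * p $ i + u * p $ i"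
        using k(1) by (simp add: w_def)
      then show "q \<in> {q. q $ i = p $ i}"
        by (simp add: algebra_simps)
    qed
    moreover have "p $ i = 0 \<or> p $ i = 1"
      using k by metis
    ultimately show ?E
      by metis
  qed
  then show ?thesis
    by (simp add: dof_points_def extreme_point_of_unit_cube ref_cube_def)
qed

section \<open>Coefficients of the fields in the space Theta\<close>

text \<open>Coefficients are indexed by list positions, so that a combination of a concrete list
  unfolds to an explicit sum. The arbitrary start \<open>n\<close> of the numbering carries the
  induction to the tail.\<close>

lemma span_set_iff:
  "q \<in> field_space.span (set fs) \<longleftrightarrow>
     (\<exists>k. q = (\<lambda>p. \<Sum>(i, f)\<leftarrow>List.enumerate n fs. k i *\<^sub>R f p))"
proof (induction fs arbitrary: n q)
  case Nil
  then show ?case by (simp add: zero_fun_def)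
next
  case (Cons f fs)
  have eq: "(\<lambda>p. \<Sum>(i, f)\<leftarrow>List.enumerate (Suc n) fs. (k(n := c)) i *\<^sub>R f p)
      = (\<lambda>p. \<Sum>(i, f)\<leftarrow>List.enumerate (Suc n) fs. k i *\<^sub>R f p)" for k c
    by (intro ext arg_cong[of _ _ sum_list] map_cong) (auto simp: in_set_enumerate_eq)
  show ?case (is "?L \<longleftrightarrow> ?R")
  proof
    assume ?L
    then obtain c where "q - (\<lambda>p. c *\<^sub>R f p) \<in> field_space.span (set fs)"
      by (auto simp: field_space.span_breakdown_eq)
    then obtain k where k: "q - (\<lambda>p. c *\<^sub>R f p) =
        (\<lambda>p. \<Sum>(i, f)\<leftarrow>List.enumerate (Suc n) fs. k i *\<^sub>R f p)"
      unfolding Cons.IH[where n = "Suc n"] by blast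
    have "q p = (\<Sum>(i, f)\<leftarrow>List.enumerate n (f # fs). (k(n := c)) i *\<^sub>R f p)" for p
      using fun_cong[OF k, of p] fun_cong[OF eq[of k c], of p] by (simp add: algebra_simps)
    then show ?R by blast
  next
    assume ?R
    then obtain k where "q = (\<lambda>p. \<Sum>(i, f)\<leftarrow>List.enumerate n (f # fs). k i *\<^sub>R f p)"
      by blast
    then have "q - (\<lambda>p. k n *\<^sub>R f p) = (\<lambda>p. \<Sum>(i, f)\<leftarrow>List.enumerate (Suc n) fs. k i *\<^sub>R f p)"
      by (simp add: fun_eq_iff)
    then have "q - (\<lambda>p. k n *\<^sub>R f p) \<in> field_space.span (set fs)"
      unfolding Cons.IH[where n = "Suc n"] by blast
    then show ?L
      by (auto simp: field_space.span_breakdown_eq)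
  qed
qed

definition serendipity :: "(nat \<Rightarrow> real) \<Rightarrow> real \<Rightarrow> real \<Rightarrow> real" where
  "serendipity c s t = c 0 + c 1 * s + c 2 * t + c 3 * (s * t) + c 4 * s^2 + c 5 * t^2
     + c 6 * (s^2 * t) + c 7 * (s * t^2)"

definition square_nodes :: "(real \<times> real) set" where
  "square_nodes = {(0, 0), (1/2, 0), (1, 0), (0, 1/2), (1, 1/2), (0, 1), (1/2, 1), (1, 1)}"

lemma serendipity_interpolation:
  "\<exists>c. \<forall>(s, t)\<in>square_nodes. serendipity c s t = w s t"
proof -
  \<comment> \<open>The sides \<open>t = 0\<close> and \<open>s = 0\<close> give the coefficients 0,
    1, 2, 4, 5; comparing second differences on opposite sides gives 6 and 7; the value at (1, 1)
    then gives 3.\<close>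
  define c where "c = (!) [w 0 0,
     - 3 * w 0 0 + 4 * w (1/2) 0 - w 1 0, - 3 * w 0 0 + 4 * w 0 (1/2) - w 0 1,
     5 * w 0 0 - 4 * w (1/2) 0 - w 1 0 - 4 * w 0 (1/2) + 4 * w 1 (1/2) - w 0 1 + 4 * w (1/2) 1 - 3 * w 1 1,
     2 * w 0 0 - 4 * w (1/2) 0 + 2 * w 1 0, 2 * w 0 0 - 4 * w 0 (1/2) + 2 * w 0 1,
     - 2 * w 0 0 + 4 * w (1/2) 0 - 2 * w 1 0 + 2 * w 0 1 - 4 * w (1/2) 1 + 2 * w 1 1,
     - 2 * w 0 0 + 4 * w 0 (1/2) - 2 * w 0 1 + 2 * w 1 0 - 4 * w 1 (1/2) + 2 * w 1 1]"
  show ?thesis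
    by (rule exI[of _ c])
      (simp add: c_def square_nodes_def serendipity_def power2_eq_square field_simps)
qed

text \<open>The solution \<open>c\<close> makes the left-hand side \<open>r\<close> times the bubble
  \<open>(s - s\<^sup>2)(t - t\<^sup>2)\<close>, which vanishes at all eight nodes.\<close>

lemma serendipity_plus_bubble_unique:
  assumes "\<forall>(s, t)\<in>square_nodes. serendipity c s t + r * (s^2 * t^2) = 0"
  shows "c 0 = 0" "c 1 = 0" "c 2 = 0" "c 3 = r" "c 4 = 0" "c 5 = 0" "c 6 = - r" "c 7 = - r"
  using assms by (simp_all add: square_nodes_def serendipity_def power2_eq_square field_simps)

text \<open>The 51 parameters exceed the 48 degrees of freedom by the three relations that will cut
  out \<open>Theta\<close>. Index 6 of \<open>a'\<close>, \<open>b'\<close>, \<open>c'\<close>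
  belongs to x y^2 z, x^2 y z, x^2 y z, and index 7 to x y z^2, x y z^2, x y^2 z.\<close>

definition theta_field ::
  "(nat \<Rightarrow> real) \<Rightarrow> (nat \<Rightarrow> real) \<Rightarrow> (nat \<Rightarrow> real) \<Rightarrow> (nat \<Rightarrow> real) \<Rightarrow> (nat \<Rightarrow> real) \<Rightarrow> (nat \<Rightarrow> real) \<Rightarrow>
    real \<Rightarrow> real \<Rightarrow> real \<Rightarrow> real^3 \<Rightarrow> real^3" where
  "theta_field a a' b b' c c' r1 r2 r3 p = vector
     [serendipity a (p$2) (p$3) + p$1 * serendipity a' (p$2) (p$3) + r1 * ((p$2)^2 * (p$3)^2),
      serendipity b (p$1) (p$3) + p$2 * serendipity b' (p$1) (p$3) + r2 * ((p$1)^2 * (p$3)^2),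
      serendipity c (p$1) (p$2) + p$3 * serendipity c' (p$1) (p$2) + r3 * ((p$1)^2 * (p$2)^2)]"

text \<open>The three relations result from eliminating the coefficients of the first three
  elements of \<^const>\<open>extra_fields\<close>; those of the last three are \<open>r3\<close>, \<open>r2\<close>, \<open>r1\<close>.\<close>

lemma Theta_iff:
  "\<theta> \<in> Theta \<longleftrightarrow>
    (\<exists>a a' b b' c c' r1 r2 r3. \<theta> = theta_field a a' b b' c c' r1 r2 r3 \<and>
       b' 7 + c' 7 = 4 * r1 \<and> a' 7 + c' 6 = 4 * r2 \<and> a' 6 + b' 6 = 4 * r3)"
    (is "_ \<longleftrightarrow> ?R")
proof -
  \<comment> \<open>Positions 0 to 41 hold the monomial fields, 14 per component, and 42 to 47 the
    extra fields in their original order.\<close>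
  define fs where "fs =
    map (\<lambda>p. vec3 p 0 0) [1, X, Y, Z, X * Y, X * Z, Y * Z, X * Y * Z, Y^2, Z^2,
      X * Y^2, X * Z^2, Y^2 * Z, Y * Z^2] @
    map (\<lambda>p. vec3 0 p 0) [1, X, Y, Z, X * Y, X * Z, Y * Z, X * Y * Z, X^2, Z^2,
      X^2 * Y, Y * Z^2, X^2 * Z, X * Z^2] @
    map (\<lambda>p. vec3 0 0 p) [1, X, Y, Z, X * Y, X * Z, Y * Z, X * Y * Z, X^2, Y^2,
      X^2 * Z, Y^2 * Z, X^2 * Y, X * Y^2] @
    [vec3 0 (X * Y * Z^2) (- (X * Y^2 * Z)),
     vec3 (- (X * Y * Z^2)) 0 (X^2 * Y * Z),
     vec3 (X * Y^2 * Z) (- (X^2 * Y * Z)) 0,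
     vec3 (2 * X * Y^2 * Z) (2 * X^2 * Y * Z) (X^2 * Y^2),
     vec3 (2 * X * Y * Z^2) (X^2 * Z^2) (2 * X^2 * Y * Z),
     vec3 (Y^2 * Z^2) (2 * X * Y * Z^2) (2 * X * Y^2 * Z)]"
  define comb where "comb k p = (\<Sum>(i, f)\<leftarrow>List.enumerate 0 fs. k i *\<^sub>R f p)" for k p
  have "Theta = field_space.span (set fs)"
    by (simp only: Theta_def fs_def monomials_x_def monomials_y_def monomials_z_def extra_fields_def
        set_append set_map list.set Un_assoc)
  then have mem: "\<theta> \<in> Theta \<longleftrightarrow> (\<exists>k. \<theta> = comb k)"
    unfolding comb_def[abs_def] using span_set_iff[of \<theta> fs 0] by (rule ssubst)
  have two: "(2 :: real^3 \<Rightarrow> real) p = 2" for p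
    by (metis one_add_one one_fun_apply plus_fun_apply)
  have sq: "(f^2) p = (f p)^2" for f :: "real^3 \<Rightarrow> real" and p
    by (simp add: power2_eq_square)
  \<comment> \<open>Each of \<open>k 42\<close>, \<open>k 43\<close>, \<open>k 44\<close> enters two
    components with opposite signs; adding the two coefficients leaves four times
    \<open>k 47\<close>, \<open>k 46\<close>, \<open>k 45\<close> respectively.\<close>
  have comb: "comb k p = vector [
      k 0 + k 1 * p$1 + k 2 * p$2 + k 3 * p$3 + k 4 * (p$1 * p$2) + k 5 * (p$1 * p$3)
        + k 6 * (p$2 * p$3) + k 7 * (p$1 * p$2 * p$3) + k 8 * (p$2)^2 + k 9 * (p$3)^2
        + k 10 * (p$1 * (p$2)^2) + k 11 * (p$1 * (p$3)^2) + k 12 * ((p$2)^2 * p$3)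
        + k 13 * (p$2 * (p$3)^2) + (2 * k 46 - k 43) * (p$1 * p$2 * (p$3)^2)
        + (k 44 + 2 * k 45) * (p$1 * (p$2)^2 * p$3) + k 47 * ((p$2)^2 * (p$3)^2),
      k 14 + k 15 * p$1 + k 16 * p$2 + k 17 * p$3 + k 18 * (p$1 * p$2) + k 19 * (p$1 * p$3)
        + k 20 * (p$2 * p$3) + k 21 * (p$1 * p$2 * p$3) + k 22 * (p$1)^2 + k 23 * (p$3)^2
        + k 24 * ((p$1)^2 * p$2) + k 25 * (p$2 * (p$3)^2) + k 26 * ((p$1)^2 * p$3)
        + k 27 * (p$1 * (p$3)^2) + (k 42 + 2 * k 47) * (p$1 * p$2 * (p$3)^2)
        + (2 * k 45 - k 44) * ((p$1)^2 * p$2 * p$3) + k 46 * ((p$1)^2 * (p$3)^2),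
      k 28 + k 29 * p$1 + k 30 * p$2 + k 31 * p$3 + k 32 * (p$1 * p$2) + k 33 * (p$1 * p$3)
        + k 34 * (p$2 * p$3) + k 35 * (p$1 * p$2 * p$3) + k 36 * (p$1)^2 + k 37 * (p$2)^2
        + k 38 * ((p$1)^2 * p$3) + k 39 * ((p$2)^2 * p$3) + k 40 * ((p$1)^2 * p$2)
        + k 41 * (p$1 * (p$2)^2) + (2 * k 47 - k 42) * (p$1 * (p$2)^2 * p$3)
        + (k 43 + 2 * k 46) * ((p$1)^2 * p$2 * p$3) + k 45 * ((p$1)^2 * (p$2)^2)]" for k p
    by (simp add: comb_def fs_def vec3_def X_def Y_def Z_def two sq vec_eq_iff forall_3 algebra_simps
        flip: numeral_2_eq_2)
  show ?thesis
  proof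
    assume "\<theta> \<in> Theta"
    then obtain k where k: "\<theta> = comb k" using mem by blast
    have "\<theta> = theta_field
        ((!) [k 0, k 2, k 3, k 6, k 8, k 9, k 12, k 13])
        ((!) [k 1, k 4, k 5, k 7, k 10, k 11, k 44 + 2 * k 45, 2 * k 46 - k 43])
        ((!) [k 14, k 15, k 17, k 19, k 22, k 23, k 26, k 27])
        ((!) [k 16, k 18, k 20, k 21, k 24, k 25, 2 * k 45 - k 44, k 42 + 2 * k 47])
        ((!) [k 28, k 29, k 30, k 32, k 36, k 37, k 40, k 41])
        ((!) [k 31, k 33, k 34, k 35, k 38, k 39, k 43 + 2 * k 46, 2 * k 47 - k 42])
        (k 47) (k 46) (k 45)"
      unfolding fun_eq_iff k comb theta_field_def serendipity_def
      by (simp add: vec_eq_iff forall_3 algebra_simps)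
    then show ?R
      by (intro exI conjI) (assumption, simp_all)
  next
    assume ?R
    then obtain a a' b b' c c' r1 r2 r3 where \<theta>: "\<theta> = theta_field a a' b b' c c' r1 r2 r3"
      and r: "b' 7 + c' 7 = 4 * r1" "a' 7 + c' 6 = 4 * r2" "a' 6 + b' 6 = 4 * r3"
      by blast
    \<comment> \<open>Positions 42 to 44 are solved from \<open>b' 7\<close>, \<open>a' 7\<close>
      and \<open>a' 6\<close>; the relations then yield the other three cubic coefficients.\<close>
    define k where "k = (!) [
      a 0, a' 0, a 1, a 2, a' 1, a' 2, a 3, a' 3, a 4, a 5, a' 4, a' 5, a 6, a 7,
      b 0, b 1, b' 0, b 2, b' 1, b 3, b' 2, b' 3, b 4, b 5, b' 4, b' 5, b 6, b 7,
      c 0, c 1, c 2, c' 0, c 3, c' 1, c' 2, c' 3, c 4, c 5, c' 4, c' 5, c 6, c 7,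
      b' 7 - 2 * r1, 2 * r2 - a' 7, a' 6 - 2 * r3, r3, r2, r1]"
    have r': "c' 7 = 4 * r1 - b' 7" "c' 6 = 4 * r2 - a' 7" "b' 6 = 4 * r3 - a' 6"
      using r by auto
    have "\<theta> = comb k"
      unfolding fun_eq_iff \<theta> comb theta_field_def serendipity_def
      by (simp add: vec_eq_iff forall_3 algebra_simps k_def r')
    then show "\<theta> \<in> Theta" using mem by blast
  qed
qed

section \<open>Unisolvence and tangential traces\<close>

text \<open>At \<open>x = 0\<close> and \<open>x = 1\<close> the expression is a serendipity
  function plus the same multiple of s^2 t^2. Uniqueness gives both the same coefficients, and
  \<open>a'\<close> is their difference.\<close>

lemma component_unique:
  assumes "\<forall>x s t. x \<in> {0, 1} \<longrightarrow> (s, t) \<in> square_nodes \<longrightarrow>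
    serendipity a s t + x * serendipity a' s t + r * (s^2 * t^2) = 0"
  shows "a' 6 = 0" "a' 7 = 0"
    "serendipity a s t + x * serendipity a' s t + r * (s^2 * t^2) = r * ((s - s^2) * (t - t^2))"
proof -
  note a = serendipity_plus_bubble_unique[of a r]
  have "\<forall>(s, t)\<in>square_nodes. serendipity (\<lambda>n. a n + a' n) s t + r * (s^2 * t^2) = 0"
    using assms[rule_format, of 1] by (auto simp: serendipity_def algebra_simps)
  note aa' = serendipity_plus_bubble_unique[OF this]
  have "\<forall>(s, t)\<in>square_nodes. serendipity a s t + r * (s^2 * t^2) = 0"
    using assms[rule_format, of 0] by auto
  note a = a[OF this]
  then have a': "a' 0 = 0" "a' 1 = 0" "a' 2 = 0" "a' 3 = 0" "a' 4 = 0" "a' 5 = 0" "a' 6 = 0" "a' 7 = 0"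
    using aa' by auto
  then show "a' 6 = 0" "a' 7 = 0" by auto
  show "serendipity a s t + x * serendipity a' s t + r * (s^2 * t^2) = r * ((s - s^2) * (t - t^2))"
    unfolding serendipity_def a a' by (simp add: algebra_simps)
qed

text \<open>The list holds the coefficients of s t - s^2 t - s t^2, which completes s^2 t^2 to the
  bubble, zero at all nodes. Hence one \<open>a'\<close> serves every \<open>r\<close>, and
  \<open>r\<close> may be chosen afterwards in terms of \<open>a'\<close>.\<close>

lemma component_interpolation:
  "\<exists>a a'. \<forall>r. \<forall>x\<in>{0, 1}. \<forall>(s, t)\<in>square_nodes.
     serendipity (\<lambda>n. a n + r * [0, 0, 0, 1, 0, 0, -1, -1] ! n) s t
       + x * serendipity a' s t + r * (s^2 * t^2) = w x s t"
proof -
  obtain a0 where a0: "\<forall>(s, t)\<in>square_nodes. serendipity a0 s t = w 0 s t"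
    using serendipity_interpolation by blast
  obtain a1 where a1: "\<forall>(s, t)\<in>square_nodes. serendipity a1 s t = w 1 s t"
    using serendipity_interpolation by blast
  have bubble: "serendipity (\<lambda>n. a0 n + r * [0, 0, 0, 1, 0, 0, -1, -1] ! n) s t + r * (s^2 * t^2)
      = serendipity a0 s t + r * ((s - s^2) * (t - t^2))" for r s t
    by (simp add: serendipity_def algebra_simps)
  have zero: "(s - s^2) * (t - t^2) = 0" if "(s, t) \<in> square_nodes" for s t
    using that by (auto simp: square_nodes_def)
  have diff: "serendipity (\<lambda>n. a1 n - a0 n) s t = serendipity a1 s t - serendipity a0 s t" for s t
    by (simp add: serendipity_def algebra_simps)
  have "serendipity (\<lambda>n. a0 n + r * [0, 0, 0, 1, 0, 0, -1, -1] ! n) s t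
       + x * serendipity (\<lambda>n. a1 n - a0 n) s t + r * (s^2 * t^2) = w x s t"
    if x: "x \<in> {0, 1}" and st: "(s, t) \<in> square_nodes" for r x s t
  proof -
    have "serendipity a0 s t = w 0 s t" "serendipity a1 s t = w 1 s t"
      using a0 a1 st by auto
    then show ?thesis
      using bubble[of r s t] zero[OF st] x by (auto simp: diff)
  qed
  then show ?thesis by blast
qed

text \<open>Here \<open>k\<close> is the coordinate fixed on the face and \<open>l\<close> the
  component's own one. With the first argument fixed, s t^2 and s^2 t^2 are merely quadratic in
  \<open>t\<close>, so six grid values determine the trace.\<close>

lemma component_zero_on_face:
  assumes "\<And>l t. l \<in> {0, 1} \<Longrightarrow> t \<in> {0, 1/2, 1} \<Longrightarrow>
    serendipity b k t + l * serendipity b' k t + r * (k^2 * t^2) = 0"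
  shows "serendipity b k t + l * serendipity b' k t + r * (k^2 * t^2) = 0"
proof -
  \<comment> \<open>linear interpolation in \<open>l\<close>, quadratic Lagrange interpolation in \<open>t\<close>\<close>
  define F where "F l t = serendipity b k t + l * serendipity b' k t + r * (k^2 * t^2)" for l t
  have "F l t =
      (1 - l) * ((1 - t) * (1 - 2 * t) * F 0 0 + 4 * t * (1 - t) * F 0 (1/2) + t * (2 * t - 1) * F 0 1)
      + l * ((1 - t) * (1 - 2 * t) * F 1 0 + 4 * t * (1 - t) * F 1 (1/2) + t * (2 * t - 1) * F 1 1)"
    unfolding F_def serendipity_def by (simp add: power2_eq_square field_simps)
  moreover have "F l t = 0" if "l \<in> {0, 1}" "t \<in> {0, 1/2, 1}" for l t
    using assms[OF that] by (simp add: F_def)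
  ultimately have "F l t = 0"
    by simp
  then show ?thesis by (simp add: F_def)
qed

text \<open>The transposition of the coefficients carries results about a fixed first argument over
  to a fixed second one.\<close>

lemma serendipity_swap:
  "serendipity c s t = serendipity ((!) [c 0, c 2, c 1, c 3, c 5, c 4, c 7, c 6]) t s"
  by (simp add: serendipity_def algebra_simps)

lemma component_zero_on_face':
  assumes "\<And>l s. l \<in> {0, 1} \<Longrightarrow> s \<in> {0, 1/2, 1} \<Longrightarrow>
    serendipity b s k + l * serendipity b' s k + r * (s^2 * k^2) = 0"
  shows "serendipity b s k + l * serendipity b' s k + r * (s^2 * k^2) = 0"
  using assms component_zero_on_face[of _ k _ r]
  unfolding serendipity_swap[of b _ k] serendipity_swap[of b' _ k] mult.commute[of _ "k^2"] by blast

lemma exists_3: "(\<exists>i::3. P i) \<longleftrightarrow> P 1 \<or> P 2 \<or> P 3"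
  by (metis exhaust_3)

text \<open>Coordinate \<open>i\<close> of a node is always 0 or 1, and at most one of the other two
  is 1/2, which excludes the centre of the square. This leaves 2 x 8 points per component.\<close>

lemma dof_points_iff:
  "p \<in> dof_points 1 \<longleftrightarrow> p$1 \<in> {0, 1} \<and> (p$2, p$3) \<in> square_nodes"
  "p \<in> dof_points 2 \<longleftrightarrow> p$2 \<in> {0, 1} \<and> (p$1, p$3) \<in> square_nodes"
  "p \<in> dof_points 3 \<longleftrightarrow> p$3 \<in> {0, 1} \<and> (p$1, p$2) \<in> square_nodes"
  unfolding mem_dof_points forall_3 exists_3 square_nodes_def by (simp, argo)+

lemma theta_field_unique:
  assumes \<theta>: "\<theta> = theta_field a a' b b' c c' r1 r2 r3"
    and r: "b' 7 + c' 7 = 4 * r1" "a' 7 + c' 6 = 4 * r2" "a' 6 + b' 6 = 4 * r3"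
    and zero: "\<And>i p. p \<in> dof_points i \<Longrightarrow> \<theta> p $ i = 0"
  shows "\<theta> = 0"
proof -
  have "\<forall>x s t. x \<in> {0, 1} \<longrightarrow> (s, t) \<in> square_nodes \<longrightarrow>
      serendipity a s t + x * serendipity a' s t + r1 * (s^2 * t^2) = 0"
    using zero[of "vector [x, s, t]" 1 for x s t] by (simp add: \<theta> theta_field_def dof_points_iff)
  note a = component_unique[OF this]
  have "\<forall>x s t. x \<in> {0, 1} \<longrightarrow> (s, t) \<in> square_nodes \<longrightarrow>
      serendipity b s t + x * serendipity b' s t + r2 * (s^2 * t^2) = 0"
    using zero[of "vector [s, x, t]" 2 for x s t] by (simp add: \<theta> theta_field_def dof_points_iff)
  note b = component_unique[OF this]
  have "\<forall>x s t. x \<in> {0, 1} \<longrightarrow> (s, t) \<in> square_nodes \<longrightarrow>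
      serendipity c s t + x * serendipity c' s t + r3 * (s^2 * t^2) = 0"
    using zero[of "vector [s, t, x]" 3 for x s t] by (simp add: \<theta> theta_field_def dof_points_iff)
  note c = component_unique[OF this]
  have "r1 = 0" "r2 = 0" "r3 = 0"
    using r a(1,2) b(1,2) c(1,2) by auto
  then show ?thesis
    unfolding \<theta> fun_eq_iff theta_field_def a(3) b(3) c(3)
    by (simp add: vec_eq_iff forall_3)
qed

lemma Theta_interpolation:
  fixes v :: "3 \<Rightarrow> real^3 \<Rightarrow> real"
  shows "\<exists>\<theta>\<in>Theta. \<forall>i. \<forall>p\<in>dof_points i. \<theta> p $ i = v i p"
proof -
  let ?\<beta> = "\<lambda>a r n. a n + r * [0, 0, 0, 1, 0, 0, -1, -1] ! n"
  obtain a a' where a: "\<And>r x s t. x \<in> {0, 1} \<Longrightarrow> (s, t) \<in> square_nodes \<Longrightarrow>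
      serendipity (?\<beta> a r) s t + x * serendipity a' s t + r * (s^2 * t^2) = v 1 (vector [x, s, t])"
    using component_interpolation[of "\<lambda>x s t. v 1 (vector [x, s, t])"] by blast
  obtain b b' where b: "\<And>r x s t. x \<in> {0, 1} \<Longrightarrow> (s, t) \<in> square_nodes \<Longrightarrow>
      serendipity (?\<beta> b r) s t + x * serendipity b' s t + r * (s^2 * t^2) = v 2 (vector [s, x, t])"
    using component_interpolation[of "\<lambda>x s t. v 2 (vector [s, x, t])"] by blast
  obtain c c' where c: "\<And>r x s t. x \<in> {0, 1} \<Longrightarrow> (s, t) \<in> square_nodes \<Longrightarrow>
      serendipity (?\<beta> c r) s t + x * serendipity c' s t + r * (s^2 * t^2) = v 3 (vector [s, t, x])"
    using component_interpolation[of "\<lambda>x s t. v 3 (vector [s, t, x])"] by blast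
  \<comment> \<open>The relations of \<open>Theta_iff\<close> solved for \<open>r1\<close>,
    \<open>r2\<close>, \<open>r3\<close>; the primed coefficients were fixed independently of
    these.\<close>
  define r1 r2 r3 where r: "r1 = (b' 7 + c' 7) / 4" "r2 = (a' 7 + c' 6) / 4" "r3 = (a' 6 + b' 6) / 4"
  define \<theta> where "\<theta> = theta_field (?\<beta> a r1) a' (?\<beta> b r2) b' (?\<beta> c r3) c' r1 r2 r3"
  have "\<theta> \<in> Theta"
    unfolding Theta_iff \<theta>_def using r
    by (intro exI conjI) (rule refl, simp_all)
  have vec: "vector [p$1, p$2, p$3] = p" for p :: "real^3"
    by (simp add: vec_eq_iff forall_3)
  have "\<theta> p $ 1 = v 1 p" if "p \<in> dof_points 1" for p
    using a[of "p$1" "p$2" "p$3" r1] that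
    by (simp add: vec \<theta>_def theta_field_def dof_points_iff)
  moreover have "\<theta> p $ 2 = v 2 p" if "p \<in> dof_points 2" for p
    using b[of "p$2" "p$1" "p$3" r2] that
    by (simp add: vec \<theta>_def theta_field_def dof_points_iff)
  moreover have "\<theta> p $ 3 = v 3 p" if "p \<in> dof_points 3" for p
    using c[of "p$3" "p$1" "p$2" r3] that
    by (simp add: vec \<theta>_def theta_field_def dof_points_iff)
  ultimately have "\<forall>i. \<forall>p\<in>dof_points i. \<theta> p $ i = v i p"
    unfolding forall_3 by blast
  with \<open>\<theta> \<in> Theta\<close> show ?thesis by blast
qed

text \<open>The trace is a polynomial determined by its nodal values, so it vanishes on the whole
  plane. Cases 1 to 3 fix the first serendipity argument of component \<open>j\<close>, cases 4 to 6
  the second.\<close>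

lemma theta_zero_on_face:
  assumes \<theta>: "\<theta> \<in> Theta" and k: "k = 0 \<or> k = 1" and f: "f = {p \<in> cbox 0 1. p $ i = k}"
    and zero: "\<And>j p. p \<in> dof_points j \<Longrightarrow> p \<in> f \<Longrightarrow> \<theta> p $ j = 0"
    and "j \<noteq> i" and p: "p $ i = k"
  shows "\<theta> p $ j = 0"
proof -
  obtain a a' b b' c c' r1 r2 r3 where \<theta>: "\<theta> = theta_field a a' b b' c c' r1 r2 r3"
    using \<theta> Theta_iff by blast
  note simps = \<theta> theta_field_def dof_points_iff square_nodes_def f mem_box_cart forall_3
  consider "i = 1" "j = 2" | "i = 1" "j = 3" | "i = 2" "j = 1" | "i = 2" "j = 3"
    | "i = 3" "j = 1" | "i = 3" "j = 2"
    using \<open>j \<noteq> i\<close> exhaust_3[of i] exhaust_3[of j] by blast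
  then show ?thesis
  proof cases
    case 1
    have "serendipity b k t + l * serendipity b' k t + r2 * (k^2 * t^2) = 0"
      if "l \<in> {0, 1}" "t \<in> {0, 1/2, 1}" for l t
      using zero[of "vector [k, l, t]" 2] that k 1 by (auto simp: simps)
    from component_zero_on_face[OF this] show ?thesis
      using p 1 by (simp add: \<theta> theta_field_def)
  next
    case 2
    have "serendipity c k t + l * serendipity c' k t + r3 * (k^2 * t^2) = 0"
      if "l \<in> {0, 1}" "t \<in> {0, 1/2, 1}" for l t
      using zero[of "vector [k, t, l]" 3] that k 2 by (auto simp: simps)
    from component_zero_on_face[OF this] show ?thesis
      using p 2 by (simp add: \<theta> theta_field_def)
  next
    case 3
    have "serendipity a k t + l * serendipity a' k t + r1 * (k^2 * t^2) = 0"
      if "l \<in> {0, 1}" "t \<in> {0, 1/2, 1}" for l t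
      using zero[of "vector [l, k, t]" 1] that k 3 by (auto simp: simps)
    from component_zero_on_face[OF this] show ?thesis
      using p 3 by (simp add: \<theta> theta_field_def)
  next
    case 4
    have "serendipity c t k + l * serendipity c' t k + r3 * (t^2 * k^2) = 0"
      if "l \<in> {0, 1}" "t \<in> {0, 1/2, 1}" for l t
      using zero[of "vector [t, k, l]" 3] that k 4 by (auto simp: simps)
    from component_zero_on_face'[OF this] show ?thesis
      using p 4 by (simp add: \<theta> theta_field_def)
  next
    case 5
    have "serendipity a t k + l * serendipity a' t k + r1 * (t^2 * k^2) = 0"
      if "l \<in> {0, 1}" "t \<in> {0, 1/2, 1}" for l t
      using zero[of "vector [l, t, k]" 1] that k 5 by (auto simp: simps)
    from component_zero_on_face'[OF this] show ?thesis
      using p 5 by (simp add: \<theta> theta_field_def)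
  next
    case 6
    have "serendipity b t k + l * serendipity b' t k + r2 * (t^2 * k^2) = 0"
      if "l \<in> {0, 1}" "t \<in> {0, 1/2, 1}" for l t
      using zero[of "vector [t, l, k]" 2] that k 6 by (auto simp: simps)
    from component_zero_on_face'[OF this] show ?thesis
      using p 6 by (simp add: \<theta> theta_field_def)
  qed
qed

text \<open>The face contains two vertices that differ by the unit vector along axis
  \<open>j\<close>.\<close>

lemma unit_normal_of_slice:
  assumes n: "unit_normal f n" and f: "f = {p \<in> cbox 0 1. p $ i = k}" and k: "k = 0 \<or> k = 1"
    and "j \<noteq> i"
  shows "n $ j = 0"
proof -
  have "axis i k \<in> f" "axis i k + axis j 1 \<in> f"
    using k \<open>j \<noteq> i\<close> by (auto simp: f mem_box_cart axis_def)
  then have "n \<bullet> (axis i k + axis j 1 - axis i k) = 0"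
    using n unfolding unit_normal_def by blast
  then show ?thesis
    by (simp add: inner_axis)
qed

theorem lemma4p1:
  shows "(\<forall>v :: 3 \<Rightarrow> real^3 \<Rightarrow> real.
            \<exists>!\<theta>. \<theta> \<in> Theta \<and> (\<forall>i. \<forall>p\<in>dof_points i. \<theta> p $ i = v i p)) \<and>
         (\<forall>f n. f facet_of ref_cube \<longrightarrow> unit_normal f n \<longrightarrow>
            (\<forall>\<theta>\<in>Theta. (\<forall>i. \<forall>p\<in>dof_points i \<inter> f. \<theta> p $ i = 0) \<longrightarrow>
               (\<forall>p\<in>f. cross3 (\<theta> p) n = 0)))"
proof (intro conjI allI impI ballI)
  fix v :: "3 \<Rightarrow> real^3 \<Rightarrow> real"
  obtain \<theta> where \<theta>: "\<theta> \<in> Theta" "\<forall>i. \<forall>p\<in>dof_points i. \<theta> p $ i = v i p"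
    using Theta_interpolation by blast
  have "\<eta> = \<theta>" if \<eta>: "\<eta> \<in> Theta" "\<forall>i. \<forall>p\<in>dof_points i. \<eta> p $ i = v i p" for \<eta>
  proof -
    have "\<eta> - \<theta> \<in> Theta"
      using \<theta>(1) \<eta>(1) unfolding Theta_def by (rule field_space.span_diff[rotated])
    then obtain a a' b b' c c' r1 r2 r3 where "\<eta> - \<theta> = theta_field a a' b b' c c' r1 r2 r3"
      "b' 7 + c' 7 = 4 * r1" "a' 7 + c' 6 = 4 * r2" "a' 6 + b' 6 = 4 * r3"
      unfolding Theta_iff by blast
    then have "\<eta> - \<theta> = 0"
      by (rule theta_field_unique) (use \<theta>(2) \<eta>(2) in simp)
    then show ?thesis by simp
  qed
  with \<theta> show "\<exists>!\<theta>. \<theta> \<in> Theta \<and> (\<forall>i. \<forall>p\<in>dof_points i. \<theta> p $ i = v i p)"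
    by blast
next
  fix f n \<theta> p
  assume facet: "f facet_of ref_cube" and n: "unit_normal f n" and \<theta>: "\<theta> \<in> Theta"
    and zero: "\<forall>i. \<forall>p\<in>dof_points i \<inter> f. \<theta> p $ i = 0" and p: "p \<in> f"
  obtain i k where k: "k = 0 \<or> k = 1" and f: "f = {p \<in> cbox 0 1. p $ i = k}"
    using facet facet_of_unit_cube unfolding ref_cube_def by blast
  \<comment> \<open>On the face, \<open>\<theta> p\<close> and \<open>n\<close> are both multiples
    of the unit vector along axis \<open>i\<close>, hence parallel.\<close>
  have "\<theta> p $ j = 0" if "j \<noteq> i" for j
    by (rule theta_zero_on_face[OF \<theta> k f _ that]) (use zero p f in auto)
  moreover have "n $ j = 0" if "j \<noteq> i" for j
    using unit_normal_of_slice[OF n f k that] .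
  ultimately show "cross3 (\<theta> p) n = 0"
    using exhaust_3[of i] by (auto simp: vec_eq_iff forall_3 cross_components)
qed

end
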